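(* Let $p$ be a prime, and let $A$ and $B$ be non-empty subsets of $\mathbb{Z}_p$ with $|B| \leq |A| \leq 2^{-20}p$ and $B$ an interval. Then there exist elements $b_1,b_2,b_3 \in B$ such that $$|A+\{b_1, b_2,b_3\}| \ge |A|+|B|-1.$$
   Context: $\mathbb{Z}_p$ is the cyclic group of prime order $p$. An interval in $\mathbb{Z}_p$ is a set of the form $[x,y]=\{x,x+1,\dots,y\}$, i.e. a set of consecutive residues. For subsets $X,Y$ of an abelian group, $X+Y=\{x+y : x\in X, y\in Y\}$. The elements $b_1,b_2,b_3$ are not required to be distinct. *)

theory Defs
  imports Complex_Main "HOL-Number_Theory.Residues" "HOL-Algebra.AbelCoset"
begin

(* The cyclic interval [x,y] = {x, x+1, ..., y} in Z/m, for residues x, y in {0..m-1}: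
   start at x and add 1 until y is first reached.  It wraps around past m-1 if y < x, and it is
   never empty; it is all of Z/m exactly when y + 1 = x modulo m. *)
definition cyclic_interval :: "int \<Rightarrow> int \<Rightarrow> int \<Rightarrow> int set" where
  "cyclic_interval m x y = (\<lambda>i. (x + i) mod m) ` {0..(y - x) mod m}"

definition is_cyclic_interval :: "int \<Rightarrow> int set \<Rightarrow> bool" where
  "is_cyclic_interval m B \<longleftrightarrow>
     (\<exists>x\<in>carrier (residue_ring m). \<exists>y\<in>carrier (residue_ring m). B = cyclic_interval m x y)"

end

(* Write B as a translate of [0,n], and let k be the number of residues mod n occurring in A, viewed
   as a set of integers in [0,p).  If k is small compared with n, then A meets a random translate
   of itself by b <= n in few points, and some 0, b, 2b already give at least 5|A|/2 elements.
   Otherwise take 0, n and a random b in [0,n).  The translates by 0 and n gain one element per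
   occupied residue; the translate by b gains (n - k)|A|/n >= n - k elements on average in the
   unoccupied residues.  Over the integers this is |A| + n in total.

   Passing to Z/p loses at most 2m elements, where m is the number of elements of A in the last n
   integers of [0,p).  Rotating A, we may assume that this window of length n is the poorest on the
   circle.  Then each point of an occupied residue outside A and A + n is hit by A + b with
   probability at least m/n, and there are so many such points that this makes up for the loss. *)
theory Submission
  imports Defs
begin

section \<open>Loss under reduction modulo p\<close>

lemma card_le_card_mod_image:
  fixes T :: "int set"
  assumes "finite T" "T \<subseteq> {0..}"
  shows "card T \<le> card ((\<lambda>x. x mod p) ` T) + card (T \<inter> {p..})"
proof -
  \<comment> \<open>Elements of [0,p) are their own residues and survive in the image; only those
    from \<open>p\<close> on can be lost.\<close>
  have "x \<in> (\<lambda>x. x mod p) ` T" if "x \<in> T" "x < p" for x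
    using that assms(2) by (intro image_eqI[of _ _ x]) auto
  then have "T - {p..} \<subseteq> (\<lambda>x. x mod p) ` T" by (meson DiffE atLeast_iff not_le subsetI)
  then have "card (T - {p..}) \<le> card ((\<lambda>x. x mod p) ` T)"
    using assms(1) by (intro card_mono) auto
  moreover have "card T = card (T - {p..}) + card (T \<inter> {p..})"
    using assms(1) by (metis add.commute card_Int_Diff)
  ultimately show ?thesis by simp
qed

text \<open>A shift by at most \<open>n\<close> can only carry elements of the last \<open>n\<close>
  integers of [0,p) past the end, and there are two such shifts.\<close>

lemma card_three_translates_le_mod:
  fixes A :: "int set"
  assumes A: "A \<subseteq> {0..<p}" and b: "b \<in> {0..n}" and c: "c \<in> {0..n}"
  defines "T \<equiv> A \<union> (+) b ` A \<union> (+) c ` A"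
  shows "card T \<le> card ((\<lambda>x. x mod p) ` T) + 2 * card (A \<inter> {p - n..<p})"
proof -
  let ?W = "A \<inter> {p - n..<p}"
  have finA: "finite A" using A finite_subset by blast
  have "T \<inter> {p..} \<subseteq> (+) b ` ?W \<union> (+) c ` ?W"
    using A b c unfolding T_def by (auto intro!: imageI)
  then have "card (T \<inter> {p..}) \<le> card ((+) b ` ?W \<union> (+) c ` ?W)"
    using finA by (intro card_mono) auto
  also have "\<dots> \<le> card ((+) b ` ?W) + card ((+) c ` ?W)" by (rule card_Un_le)
  also have "\<dots> \<le> 2 * card ?W"
    using card_image_le[of ?W "(+) b"] card_image_le[of ?W "(+) c"] finA by simp
  finally have "card (T \<inter> {p..}) \<le> 2 * card ?W" .
  moreover have "card T \<le> card ((\<lambda>x. x mod p) ` T) + card (T \<inter> {p..})"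
    using A b c finA unfolding T_def by (intro card_le_card_mod_image) auto
  ultimately show ?thesis by simp
qed

section \<open>Few occupied residues\<close>

lemma card_window_le_card_mod_image:
  fixes A :: "int set"
  assumes "finite A" "y - x \<le> n"
  shows "card {z \<in> {x..<y}. z \<in> A} \<le> card ((\<lambda>a. a mod n) ` A)"
proof (rule card_inj_on_le[where f = "\<lambda>a. a mod n"])
  show "inj_on (\<lambda>a. a mod n) {z \<in> {x..<y}. z \<in> A}"
  proof (rule inj_onI)
    fix u v assume "u \<in> {z \<in> {x..<y}. z \<in> A}" "v \<in> {z \<in> {x..<y}. z \<in> A}" "u mod n = v mod n"
    then have "n dvd u - v" "\<bar>u - v\<bar> < n" using assms(2) by (auto simp: mod_eq_dvd_iff)
    then show "u = v" using dvd_imp_le_int[of "u - v" n] by auto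
  qed
qed (use assms in auto)

text \<open>Double counting: for fixed \<open>a\<close>, the points \<open>a + b\<close> run through
  \<open>n\<close> consecutive integers, which contain at most one element of \<open>A\<close> per
  occupied residue.\<close>

lemma sum_card_translate_inter_le:
  fixes A :: "int set" and n :: nat
  assumes "finite A"
  shows "(\<Sum>b\<in>{1..int n}. card {a\<in>A. a + b \<in> A})
    \<le> card A * card ((\<lambda>a. a mod int n) ` A)"
proof -
  let ?k = "card ((\<lambda>a. a mod int n) ` A)"
  have "(\<Sum>b\<in>{1..int n}. card {a\<in>A. a + b \<in> A})
      = (\<Sum>a\<in>A. card {b\<in>{1..int n}. a + b \<in> A})"
    using assms by (intro sum_multicount_gen) auto
  also have "\<dots> \<le> (\<Sum>a\<in>A. ?k)"
  proof (rule sum_mono)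
    fix a assume "a \<in> A"
    have "card {b\<in>{1..int n}. a + b \<in> A} = card {z\<in>{a+1..<a+1+int n}. z \<in> A}"
      by (rule bij_betw_same_card[where f = "(+) a"], rule bij_betw_byWitness[where f' = "\<lambda>z. z - a"]) auto
    also have "\<dots> \<le> ?k" using assms by (intro card_window_le_card_mod_image) auto
    finally show "card {b\<in>{1..int n}. a + b \<in> A} \<le> ?k" .
  qed
  finally show ?thesis by simp
qed

lemma card_translate_inter:
  fixes A :: "int set"
  shows "card ((+) c ` A \<inter> (+) (c + d) ` A) = card {a\<in>A. a + d \<in> A}"
  by (rule bij_betw_same_card[where f = "\<lambda>z. z - c - d"],
      rule bij_betw_byWitness[where f' = "\<lambda>a. a + c + d"]) (auto simp: algebra_simps image_iff)

lemma card_translate_int: "card ((+) c ` A) = card (A :: int set)"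
  by (simp add: card_image)

text \<open>The shifts 0, b, 2b have pairwise differences b, b, 2b, so with \<open>f d\<close> the
  overlap of \<open>A\<close> with its translate by \<open>d\<close>, the union loses at most
  \<open>2 * f b + f (2 * b)\<close> from 3|A|. Averaging over \<open>b\<close> up to n/2 makes this
  loss at most |A|/2 for some \<open>b\<close>.\<close>

lemma sparse_residues_large_sum:
  fixes A :: "int set" and n :: nat
  assumes finA: "finite A" and "A \<noteq> {}"
    and k: "6 * card ((\<lambda>a. a mod int n) ` A) \<le> n div 2"
  shows "\<exists>b. b \<ge> 0 \<and> 2 * b \<le> int n \<and>
    5 * card A \<le> 2 * card (A \<union> (+) b ` A \<union> (+) (2 * b) ` A)"
proof -
  define k where "k = card ((\<lambda>a. a mod int n) ` A)"
  define h where "h = n div 2"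
  define f where "f b = card {a\<in>A. a + b \<in> A}" for b :: int
  have "k > 0" using assms by (auto simp: k_def card_gt_0_iff)
  then have h: "h > 0" "6 * k \<le> h" using k by (auto simp: h_def k_def)
  have S: "sum f {1..int n} \<le> card A * k"
    unfolding f_def k_def using sum_card_translate_inter_le[OF finA] .
  have "sum f {1..int h} \<le> sum f {1..int n}"
    by (rule sum_mono2) (auto simp: h_def)
  moreover have "(\<Sum>b\<in>{1..int h}. f (2 * b)) = sum f ((*) 2 ` {1..int h})"
    by (subst sum.reindex) (auto simp: inj_on_def)
  moreover have "\<dots> \<le> sum f {1..int n}"
    by (rule sum_mono2) (auto simp: h_def)
  \<comment> \<open>For \<open>b \<le> h\<close> both \<open>b\<close> and \<open>2 * b\<close> stay
    in \<open>{1..n}\<close>, and doubling is injective, so three copies of the bound on the full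
    sum suffice.\<close>
  ultimately have "(\<Sum>b\<in>{1..int h}. 2 * f b + f (2 * b)) \<le> 3 * (card A * k)"
    using S by (simp add: sum.distrib flip: sum_distrib_left)
  moreover have "\<exists>b\<in>{1..int h}. 2 * (2 * f b + f (2 * b)) \<le> card A"
  proof (rule ccontr)
    assume "\<not> ?thesis"
    then have "card A < 2 * (2 * f b + f (2 * b))" if "b \<in> {1..int h}" for b
      using that by (meson not_le)
    then have "(\<Sum>b\<in>{1..int h}. 2 * (2 * f b + f (2 * b))) > (\<Sum>b\<in>{1..int h}. card A)"
      using h by (intro sum_strict_mono) auto
    then have "card A * h < 2 * (\<Sum>b\<in>{1..int h}. 2 * f b + f (2 * b))"
      by (simp only: sum_distrib_left[symmetric] sum_constant) (simp add: mult.commute)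
    \<comment> \<open>The source of the constant 6: the average loss is at most 3|A|k/h, which is at
      most |A|/2 once 6k \<le> h.\<close>
    moreover have "card A * (6 * k) \<le> card A * h" using h(2) by (rule mult_left_mono) simp
    ultimately show False
      using \<open>(\<Sum>b\<in>{1..int h}. 2 * f b + f (2 * b)) \<le> 3 * (card A * k)\<close> by linarith
  qed
  then obtain b where b: "b \<in> {1..int h}" "2 * (2 * f b + f (2 * b)) \<le> card A" by blast
  let ?X = "(+) b ` A" and ?Y = "(+) (2 * b) ` A"
  have "card (A \<inter> ?X) = f b" using card_translate_inter[of 0 A b] by (simp add: f_def)
  moreover have "card (A \<inter> ?Y) = f (2 * b)"
    using card_translate_inter[of 0 A "2 * b"] by (simp add: f_def)
  moreover have "card (?X \<inter> ?Y) = f b"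
    using card_translate_inter[of b A b] by (simp add: f_def)
  moreover have "card ((A \<union> ?X) \<inter> ?Y) \<le> card (A \<inter> ?Y) + card (?X \<inter> ?Y)"
    by (metis Int_Un_distrib2 card_Un_le)
  moreover have "card A + card ?X = card (A \<union> ?X) + card (A \<inter> ?X)"
    using finA by (intro card_Un_Int) auto
  moreover have "card (A \<union> ?X) + card ?Y = card (A \<union> ?X \<union> ?Y) + card ((A \<union> ?X) \<inter> ?Y)"
    using finA by (intro card_Un_Int) auto
  ultimately have "5 * card A \<le> 2 * card (A \<union> ?X \<union> ?Y)"
    using b(2) by (simp add: card_translate_int)
  then show ?thesis using b(1) by (intro exI[of _ b]) (auto simp: h_def)
qed

section \<open>Many occupied residues\<close>

lemma card_mod_image_le_card_translate_diff:
  fixes A :: "int set"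
  assumes finA: "finite A" and "n > 0"
  shows "card ((\<lambda>a. a mod n) ` A) \<le> card ((+) n ` A - A)"
proof (rule surj_card_le[where f = "\<lambda>x. x mod n"])
  show "(\<lambda>a. a mod n) ` A \<subseteq> (\<lambda>x. x mod n) ` ((+) n ` A - A)"
  proof
    fix c assume "c \<in> (\<lambda>a. a mod n) ` A"
    then have ne: "{a\<in>A. a mod n = c} \<noteq> {}" by auto
    \<comment> \<open>The largest element of \<open>A\<close> in a residue class: adding
      \<open>n\<close> stays in the class and leaves \<open>A\<close>, so each occupied class gains
      an element.\<close>
    define M where "M = Max {a\<in>A. a mod n = c}"
    have fin: "finite {a\<in>A. a mod n = c}" using finA by auto
    have M: "M \<in> A" "M mod n = c" using Max_in[OF fin ne] by (auto simp: M_def)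
    have "n + M \<notin> A"
      using Max_ge[OF fin, of "n + M"] M \<open>n > 0\<close> by (auto simp: M_def)
    then show "c \<in> (\<lambda>x. x mod n) ` ((+) n ` A - A)"
      using M by (intro image_eqI[of _ _ "n + M"]) auto
  qed
qed (use finA in auto)

text \<open>Two disjoint sources of new points \<open>a + b\<close>: those in unoccupied residues
  give the first term, and those in occupied residues but outside \<open>S\<close> give the second,
  each such point being hit for at least \<open>m\<close> shifts.\<close>

lemma sum_card_new_ge:
  fixes A :: "int set" and n q m :: nat
  assumes finA: "finite A" and n: "n > 0"
    and m: "\<And>x. int n \<le> x \<Longrightarrow> x < int n * (int q + 1) \<Longrightarrow> m \<le> card {z\<in>{x - int n + 1..<x + 1}. z \<in> A}"
  defines "K \<equiv> (\<lambda>a. a mod int n) ` A" and "S \<equiv> A \<union> (+) (int n) ` A"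
  shows "(int n - int (card K)) * int (card A) + int m * (int (card K) * int q - 2 * int (card A))
    \<le> (\<Sum>b\<in>{0..<int n}. int (card {a\<in>A. a + b \<notin> S}))"
proof -
  \<comment> \<open>The points outside \<open>S\<close> in occupied residues, over the blocks 1 to q
    of length \<open>n\<close>. Block 0 is left out so that \<open>n \<le> x\<close>, as the
    hypothesis on windows requires.\<close>
  define X where "X = (\<lambda>(c, j). c + int n * j) ` (K \<times> {1..int q}) - S"
  have finK: "finite K" and finS: "finite S" using finA by (auto simp: K_def S_def)
  have Kn: "K \<subseteq> {0..<int n}" using n by (auto simp: K_def)
  have finX: "finite X" using finK by (auto simp: X_def)

  have X_mod: "x mod int n \<in> K" if "x \<in> X" for x
    using that Kn by (auto simp: X_def)
  have X_bds: "int n \<le> x" "x < int n * (int q + 1)" if "x \<in> X" for x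
  proof -
    obtain z where "z \<in> K \<times> {1..int q}" "x = (\<lambda>(c, j). c + int n * j) z"
      using \<open>x \<in> X\<close> unfolding X_def by blast
    then obtain c j where cj: "c \<in> K" "j \<in> {1..int q}" "x = c + int n * j"
      by (cases z) auto
    have "int n * 1 \<le> int n * j" "int n * j \<le> int n * int q"
      using cj by (intro mult_left_mono; simp)+
    moreover have "0 \<le> c" "c < int n" using cj(1) Kn by auto
    ultimately show "int n \<le> x" "x < int n * (int q + 1)"
      unfolding cj(3) distrib_left by linarith+
  qed

  have inj: "inj_on (\<lambda>(c, j). c + int n * j) (K \<times> {1..int q})"
  proof (rule inj_onI, clarify)
    fix c j c' j' assume "c \<in> K" "c' \<in> K" and eq: "c + int n * j = c' + int n * j'"
    then have "c \<in> {0..<int n}" "c' \<in> {0..<int n}" using Kn by auto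
    then have c: "(c + int n * j) mod int n = c" "(c' + int n * j') mod int n = c'" by auto
    then have "c = c'" using eq by simp
    then show "c = c' \<and> j = j'" using eq n by simp
  qed
  have "card K * q = card ((\<lambda>(c, j). c + int n * j) ` (K \<times> {1..int q}))"
    by (simp add: card_image[OF inj] card_cartesian_product)
  \<comment> \<open>Of the |K|q candidates, removing \<open>S\<close> deletes at most |S| \<le>
    2|A|.\<close>
  moreover have "card ((\<lambda>(c, j). c + int n * j) ` (K \<times> {1..int q})) - card S \<le> card X"
    unfolding X_def using finS by (rule diff_card_le_card_Diff)
  moreover have "card S \<le> 2 * card A"
    unfolding S_def by (rule order.trans[OF card_Un_le]) (simp add: card_translate_int)
  ultimately have "card K * q \<le> card X + 2 * card A" by linarith
  then have "int (card K * q) \<le> int (card X + 2 * card A)" by (simp only: of_nat_le_iff)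
  then have cardX: "int (card K) * int q - 2 * int (card A) \<le> int (card X)" by simp

  have "(\<Sum>b\<in>{0..<int n}. card {a\<in>A. (a + b) mod int n \<notin> K})
      = (\<Sum>a\<in>A. card {b\<in>{0..<int n}. (a + b) mod int n \<notin> K})"
    using finA by (intro sum_multicount_gen) auto
  also have "\<dots> = (\<Sum>a\<in>A. n - card K)"
  proof (rule sum.cong[OF refl])
    fix a assume "a \<in> A"
    \<comment> \<open>For fixed \<open>a\<close> the map from \<open>b\<close> to
      \<open>(a + b) mod n\<close> permutes the residues, so exactly n - |K| shifts land in
      unoccupied ones.\<close>
    have "card {b\<in>{0..<int n}. (a + b) mod int n \<notin> K} = card ({0..<int n} - K)"
    proof (rule bij_betw_same_card[where f = "\<lambda>b. (a + b) mod int n"],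
        rule bij_betw_byWitness[where f' = "\<lambda>c. (c - a) mod int n"])
      show "\<forall>b\<in>{b\<in>{0..<int n}. (a + b) mod int n \<notin> K}. ((a + b) mod int n - a) mod int n = b"
        by (auto simp: mod_simps)
      show "\<forall>c\<in>{0..<int n} - K. (a + (c - a) mod int n) mod int n = c"
        by (auto simp: mod_simps)
      show "(\<lambda>c. (c - a) mod int n) ` ({0..<int n} - K) \<subseteq> {b\<in>{0..<int n}. (a + b) mod int n \<notin> K}"
        using n by (auto simp: mod_simps)
    qed (use n in auto)
    also have "\<dots> = n - card K" using Kn finK by (simp add: card_Diff_subset)
    finally show "card {b\<in>{0..<int n}. (a + b) mod int n \<notin> K} = n - card K" .
  qed
  finally have empty_classes: "(\<Sum>b\<in>{0..<int n}. card {a\<in>A. (a + b) mod int n \<notin> K})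
      = (n - card K) * card A" by simp

  have "(\<Sum>b\<in>{0..<int n}. card {a\<in>A. a + b \<in> X})
      = (\<Sum>b\<in>{0..<int n}. card {x\<in>X. x - b \<in> A})"
  proof (rule sum.cong[OF refl])
    fix b :: int
    show "card {a\<in>A. a + b \<in> X} = card {x\<in>X. x - b \<in> A}"
      by (rule bij_betw_same_card[where f = "\<lambda>a. a + b"],
          rule bij_betw_byWitness[where f' = "\<lambda>x. x - b"]) auto
  qed
  also have "\<dots> = (\<Sum>x\<in>X. card {b\<in>{0..<int n}. x - b \<in> A})"
    using finX by (intro sum_multicount_gen) auto
  also have "\<dots> \<ge> (\<Sum>x\<in>X. m)"
  proof (rule sum_mono)
    fix x assume "x \<in> X"
    \<comment> \<open>The points \<open>x - b\<close> are the \<open>n\<close> consecutive integers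
      ending at \<open>x\<close>, a window with at least \<open>m\<close> elements of
      \<open>A\<close>.\<close>
    have "card {b\<in>{0..<int n}. x - b \<in> A} = card {z\<in>{x - int n + 1..<x + 1}. z \<in> A}"
      by (rule bij_betw_same_card[where f = "\<lambda>b. x - b"],
          rule bij_betw_byWitness[where f' = "\<lambda>z. x - z"]) auto
    then show "m \<le> card {b\<in>{0..<int n}. x - b \<in> A}"
      using m X_bds[OF \<open>x \<in> X\<close>] by simp
  qed
  finally have full_classes: "m * card X \<le> (\<Sum>b\<in>{0..<int n}. card {a\<in>A. a + b \<in> X})"
    by (simp add: mult.commute)

  have "card {a\<in>A. (a + b) mod int n \<notin> K} + card {a\<in>A. a + b \<in> X} \<le> card {a\<in>A. a + b \<notin> S}" for b
  proof -
    \<comment> \<open>Translation by \<open>n\<close> preserves residues, so \<open>S\<close> lies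
      in occupied classes and a point in an unoccupied class is new.\<close>
    have S_mod: "x mod int n \<in> K" if "x \<in> S" for x using that by (auto simp: S_def K_def)
    have "card {a\<in>A. (a + b) mod int n \<notin> K} + card {a\<in>A. a + b \<in> X}
        = card ({a\<in>A. (a + b) mod int n \<notin> K} \<union> {a\<in>A. a + b \<in> X})"
      using finA X_mod by (intro card_Un_disjoint[symmetric]) auto
    also have "\<dots> \<le> card {a\<in>A. a + b \<notin> S}"
      using finA S_mod by (intro card_mono) (auto simp: X_def)
    finally show ?thesis .
  qed
  then have "(\<Sum>b\<in>{0..<int n}. card {a\<in>A. (a + b) mod int n \<notin> K} + card {a\<in>A. a + b \<in> X})
      \<le> (\<Sum>b\<in>{0..<int n}. card {a\<in>A. a + b \<notin> S})" by (rule sum_mono)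
  then have "(n - card K) * card A + m * card X \<le> (\<Sum>b\<in>{0..<int n}. card {a\<in>A. a + b \<notin> S})"
    using empty_classes full_classes by (simp add: sum.distrib)
  then have "int ((n - card K) * card A + m * card X)
      \<le> int (\<Sum>b\<in>{0..<int n}. card {a\<in>A. a + b \<notin> S})" by (simp only: of_nat_le_iff)
  moreover have "card K \<le> n" using card_mono[OF _ Kn] by simp
  moreover have "int m * (int (card K) * int q - 2 * int (card A)) \<le> int m * int (card X)"
    using cardX by (intro mult_left_mono) auto
  ultimately show ?thesis by (simp add: of_nat_diff)
qed

text \<open>Some \<open>b\<close> does at least as well as the average, n - k + 2m new points, and
  the translate by \<open>n\<close> supplies the missing \<open>k\<close>. The surplus
  \<open>2 * m\<close> is there to pay for the later reduction modulo p.\<close>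

lemma dense_residues_large_sum:
  fixes A :: "int set" and n q m :: nat
  assumes finA: "finite A" and n: "n > 0" and nA: "n \<le> card A"
    and m: "\<And>x. int n \<le> x \<Longrightarrow> x < int n * (int q + 1) \<Longrightarrow> m \<le> card {z\<in>{x - int n + 1..<x + 1}. z \<in> A}"
    and k: "2 * card A + 2 * n \<le> card ((\<lambda>a. a mod int n) ` A) * q"
  shows "\<exists>b\<in>{0..int n}.
    card A + n + 2 * m \<le> card (A \<union> (+) b ` A \<union> (+) (int n) ` A)"
proof -
  define k where "k = card ((\<lambda>a. a mod int n) ` A)"
  define S where "S = A \<union> (+) (int n) ` A"
  have kn: "k \<le> n"
  proof -
    have "(\<lambda>a. a mod int n) ` A \<subseteq> {0..<int n}" using n by auto
    from card_mono[OF _ this] show ?thesis by (simp add: k_def)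
  qed
  have "int (2 * card A + 2 * n) \<le> int (k * q)" using k unfolding k_def by (simp only: of_nat_le_iff)
  \<comment> \<open>There are at least kq - 2|A| \<ge> 2n usable points, each hit by
    \<open>m\<close> of the \<open>n\<close> shifts: an average of 2m per shift.\<close>
  then have "int m * (2 * int n) \<le> int m * (int k * int q - 2 * int (card A))"
    by (intro mult_left_mono) auto
  moreover have "(int n - int k) * int n \<le> (int n - int k) * int (card A)"
    using kn nA by (intro mult_left_mono) auto
  ultimately have sum_ge: "int n * (int n - int k + 2 * int m)
      \<le> (\<Sum>b\<in>{0..<int n}. int (card {a\<in>A. a + b \<notin> S}))"
    using sum_card_new_ge[of A n q m, OF finA n m] unfolding k_def S_def by (simp add: algebra_simps)
  have "\<exists>b\<in>{0..<int n}. int n - int k + 2 * int m \<le> int (card {a\<in>A. a + b \<notin> S})"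
  proof (rule ccontr)
    assume "\<not> ?thesis"
    then have "int (card {a\<in>A. a + b \<notin> S}) < int n - int k + 2 * int m" if "b \<in> {0..<int n}" for b
      using that by (meson not_le)
    then have "(\<Sum>b\<in>{0..<int n}. int (card {a\<in>A. a + b \<notin> S}))
        < (\<Sum>b\<in>{0..<int n}. int n - int k + 2 * int m)"
      using n by (intro sum_strict_mono) auto
    then show False using sum_ge by simp
  qed
  then obtain b where b: "b \<in> {0..<int n}" "n + 2 * m \<le> k + card {a\<in>A. a + b \<notin> S}"
    using kn by force
  have "card {a\<in>A. a + b \<notin> S} = card ((+) b ` A - S)"
    by (rule bij_betw_same_card[where f = "(+) b"],
        rule bij_betw_byWitness[where f' = "\<lambda>x. x - b"]) (auto simp: add.commute)
  moreover have "card (S \<union> ((+) b ` A - S)) = card S + card ((+) b ` A - S)"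
    using finA by (intro card_Un_disjoint) (auto simp: S_def)
  moreover have "S \<union> ((+) b ` A - S) = A \<union> (+) b ` A \<union> (+) (int n) ` A" by (auto simp: S_def)
  moreover have "card S = card A + card ((+) (int n) ` A - A)"
  proof -
    have "S = A \<union> ((+) (int n) ` A - A)" by (auto simp: S_def)
    then show ?thesis using finA by (metis Diff_disjoint card_Un_disjoint finite_Diff finite_imageI)
  qed
  moreover have "k \<le> card ((+) (int n) ` A - A)"
    unfolding k_def using finA n by (intro card_mod_image_le_card_translate_diff) auto
  ultimately show ?thesis using b by (intro bexI[of _ b]) auto
qed

section \<open>Both cases modulo p\<close>

lemma three_translates_cyclic:
  fixes A :: "int set" and n p :: nat
  assumes A: "A \<subseteq> {0..<int p}" and n: "n > 0" and nA: "n \<le> card A" and p: "100 * card A \<le> p"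
    and window: "\<And>x. int n \<le> x \<Longrightarrow> x < int p \<Longrightarrow>
      card (A \<inter> {int p - int n..<int p}) \<le> card {z\<in>{x - int n + 1..<x + 1}. z \<in> A}"
  shows "\<exists>b\<in>{0..int n}. \<exists>c\<in>{0..int n}.
    card A + n \<le> card ((\<lambda>x. x mod int p) ` (A \<union> (+) b ` A \<union> (+) c ` A))"
proof -
  define k where "k = card ((\<lambda>a. a mod int n) ` A)"
  define m where "m = card (A \<inter> {int p - int n..<int p})"
  have finA: "finite A" using A finite_subset by blast
  show ?thesis
  proof (cases "6 * k \<le> n div 2")
    case True
    obtain b where b: "b \<ge> 0" "2 * b \<le> int n"
      "5 * card A \<le> 2 * card (A \<union> (+) b ` A \<union> (+) (2 * b) ` A)"
      using sparse_residues_large_sum[OF finA, of n] True nA n unfolding k_def by fastforce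
    \<comment> \<open>A window of length \<open>n\<close> has at most \<open>k\<close> elements, so
      reduction costs at most 2k \<le> n/6. As n \<le> |A|, the size 5|A|/2 can absorb this.\<close>
    have "A \<inter> {int p - int n..<int p} = {z \<in> {int p - int n..<int p}. z \<in> A}" by auto
    then have "m \<le> k"
      using card_window_le_card_mod_image[OF finA, of "int p" "int p - int n" "int n"]
      by (simp add: m_def k_def)
    moreover have "card (A \<union> (+) b ` A \<union> (+) (2 * b) ` A)
        \<le> card ((\<lambda>x. x mod int p) ` (A \<union> (+) b ` A \<union> (+) (2 * b) ` A)) + 2 * m"
      unfolding m_def using b by (intro card_three_translates_le_mod[OF A]) auto
    ultimately have "card A + n \<le> card ((\<lambda>x. x mod int p) ` (A \<union> (+) b ` A \<union> (+) (2 * b) ` A))"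
      using b(3) True nA by linarith
    then show ?thesis using b by (intro bexI[of _ b] bexI[of _ "2 * b"]) auto
  next
    case False
    \<comment> \<open>One less than the number of full blocks of length \<open>n\<close> in [0,p):
      block 0 is not counted, and the remaining \<open>q\<close> blocks end by \<open>p\<close>,
      where the window hypothesis still applies.\<close>
    define q where "q = p div n - 1"
    have "n \<le> p" using nA p by linarith
    then have "p div n > 0" using n by (simp add: div_greater_zero_iff)
    then have q: "q + 1 = p div n" by (simp add: q_def)
    have "n * (q + 1) \<le> p" unfolding q by simp
    then have qp: "int n * (int q + 1) \<le> int p"
      by (metis of_nat_1 of_nat_add of_nat_le_iff of_nat_mult)
    have "p < n * (q + 2)"
      using q n dividend_less_times_div[of n p] by (simp add: algebra_simps)
    then have "p \<le> n * q + 2 * n" by (simp add: algebra_simps)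
    moreover have "n * q \<le> 12 * k * q" using False by (intro mult_right_mono) auto
    \<comment> \<open>From n \<le> 12k one gets 12kq \<ge> nq \<ge> p - 2n \<ge> 100|A| - 2n, which
      exceeds 24|A| + 24n because n \<le> |A|.\<close>
    ultimately have "2 * card A + 2 * n \<le> k * q" using p nA by linarith
    then obtain b where b: "b \<in> {0..int n}"
      "card A + n + 2 * m \<le> card (A \<union> (+) b ` A \<union> (+) (int n) ` A)"
      using dense_residues_large_sum[OF finA n nA, of q m] window qp
      unfolding k_def m_def by fastforce
    have "card (A \<union> (+) b ` A \<union> (+) (int n) ` A)
        \<le> card ((\<lambda>x. x mod int p) ` (A \<union> (+) b ` A \<union> (+) (int n) ` A)) + 2 * m"
      unfolding m_def using b by (intro card_three_translates_le_mod[OF A]) auto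
    then show ?thesis using b by (intro bexI[of _ b] bexI[of _ "int n"]) auto
  qed
qed

section \<open>Rotation and the cyclic statement\<close>

lemma card_translate_mod:
  fixes T :: "int set"
  shows "card ((\<lambda>x. (x + s) mod p) ` T) = card ((\<lambda>x. x mod p) ` T)"
proof (rule bij_betw_same_card[where f = "\<lambda>y. (y - s) mod p"],
    rule bij_betw_byWitness[where f' = "\<lambda>y. (y + s) mod p"])
qed (auto simp: mod_simps image_iff)

text \<open>Among all cyclic windows of length \<open>n\<close>, take one with fewest elements of
  \<open>A\<close> and rotate it to the end of [0,p).\<close>

lemma exists_rotation_minimal_window:
  fixes A :: "int set" and n p :: nat
  assumes A: "A \<subseteq> {0..<int p}" and p: "p > 0"
  obtains A' s where "A' \<subseteq> {0..<int p}" and "A = (\<lambda>a. (a + s) mod int p) ` A'" and "card A' = card A"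
    and "\<And>x. int n \<le> x \<Longrightarrow> x < int p \<Longrightarrow>
      card (A' \<inter> {int p - int n..<int p}) \<le> card {z\<in>{x - int n + 1..<x + 1}. z \<in> A'}"
proof -
  define W where "W t = card {i\<in>{0..<int n}. (t + i) mod int p \<in> A}" for t :: int
  obtain t where t: "\<And>u. W t \<le> W u" using ex_has_least_nat[of "\<lambda>_. True" 0 W] by auto
  \<comment> \<open>With this shift the position p - n of \<open>A'\<close> corresponds to
    \<open>t\<close> in \<open>A\<close>, so the minimal window becomes the last one.\<close>
  define s where "s = t + int n"
  define A' where "A' = {y\<in>{0..<int p}. (y + s) mod int p \<in> A}"
  have bij: "bij_betw (\<lambda>a. (a + s) mod int p) A' A"
    by (rule bij_betw_byWitness[where f' = "\<lambda>a. (a - s) mod int p"])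
      (use A p in \<open>auto simp: A'_def mod_simps\<close>)
  \<comment> \<open>Such a window lies inside [0,p), so counting in \<open>A'\<close> without
    wrap-around agrees with the cyclic count \<open>W\<close>.\<close>
  have win: "card {z\<in>{x - int n + 1..<x + 1}. z \<in> A'} = W (t + x + 1)"
    if "int n \<le> x + 1" "x < int p" for x
    unfolding W_def
    by (rule bij_betw_same_card[where f = "\<lambda>z. z - (x - int n + 1)"],
        rule bij_betw_byWitness[where f' = "\<lambda>i. i + (x - int n + 1)"])
      (use that in \<open>auto simp: A'_def s_def algebra_simps\<close>)
  show thesis
  proof (rule that)
    show "A' \<subseteq> {0..<int p}" by (auto simp: A'_def)
    show "A = (\<lambda>a. (a + s) mod int p) ` A'" using bij by (simp add: bij_betw_def)
    show "card A' = card A" using bij by (rule bij_betw_same_card)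
    fix x assume x: "int n \<le> x" "x < int p"
    have "card (A' \<inter> {int p - int n..<int p}) = card {z\<in>{int p - 1 - int n + 1..<int p - 1 + 1}. z \<in> A'}"
      by (rule arg_cong[where f = card]) auto
    also have "\<dots> = W (t + int p)" using win[of "int p - 1"] x by simp
    also have "\<dots> = W t"
    proof -
      have "(t + int p + i) mod int p = (t + i) mod int p" for i
        by (metis add.assoc add.commute mod_add_self2)
      then show ?thesis by (simp add: W_def)
    qed
    finally show "card (A' \<inter> {int p - int n..<int p}) \<le> card {z\<in>{x - int n + 1..<x + 1}. z \<in> A'}"
      using t win[of x] x by simp
  qed
qed

theorem theorem6:
  fixes p :: nat and A B :: "int set"
  assumes "prime p"
    and "A \<subseteq> carrier (residue_ring (int p))" and "A \<noteq> {}"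
    and "B \<subseteq> carrier (residue_ring (int p))" and "B \<noteq> {}"
    and "card B \<le> card A"
    and "real (card A) \<le> real p / 2 ^ 20"
    and "is_cyclic_interval (int p) B"
  shows "\<exists>b\<^sub>1\<in>B. \<exists>b\<^sub>2\<in>B. \<exists>b\<^sub>3\<in>B.
    card (A <+>\<^bsub>residue_ring (int p)\<^esub> {b\<^sub>1, b\<^sub>2, b\<^sub>3}) \<ge> card A + card B - 1"
proof -
  have p: "p > 0" using assms(1) prime_gt_0_nat by blast
  have A: "A \<subseteq> {0..<int p}" using assms(2) by (auto simp: residue_ring_def)
  obtain x y where B: "B = (\<lambda>i. (x + i) mod int p) ` {0..(y - x) mod int p}"
    using assms(8) by (auto simp: is_cyclic_interval_def cyclic_interval_def)
  \<comment> \<open>\<open>B\<close> is the translate by \<open>x\<close> of [0,n], so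
    \<open>n\<close> is one less than |B|.\<close>
  define n where "n = nat ((y - x) mod int p)"
  have B: "B = (\<lambda>i. (x + i) mod int p) ` {0..int n}" and n: "n < p"
    using B p by (simp_all add: n_def nat_less_iff)
  have "inj_on (\<lambda>i. (x + i) mod int p) {0..int n}"
    by (rule inj_on_inverseI[where g = "\<lambda>z. (z - x) mod int p"]) (use n in \<open>auto simp: mod_simps\<close>)
  then have cardB: "card B = n + 1" unfolding B by (simp add: card_image)
  have "100 * real (card A) \<le> real p" using assms(7) by simp
  then have "real (100 * card A) \<le> real p" by simp
  then have Ap: "100 * card A \<le> p" by (simp only: of_nat_le_iff)
  have sumset: "A <+>\<^bsub>residue_ring (int p)\<^esub> X = (\<Union>b\<in>X. (\<lambda>a. (a + b) mod int p) ` A)" for X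
    by (auto simp: set_add_def set_mult_def residue_ring_def)
  obtain A' s where A': "A' \<subseteq> {0..<int p}" "A = (\<lambda>a. (a + s) mod int p) ` A'" "card A' = card A"
    and window: "\<And>x. int n \<le> x \<Longrightarrow> x < int p \<Longrightarrow>
      card (A' \<inter> {int p - int n..<int p}) \<le> card {z\<in>{x - int n + 1..<x + 1}. z \<in> A'}"
    by (rule exists_rotation_minimal_window[OF A p, of n]) (rule that; assumption)
  have "\<exists>b\<in>{0..int n}. \<exists>c\<in>{0..int n}.
      card A' + n \<le> card ((\<lambda>x. x mod int p) ` (A' \<union> (+) b ` A' \<union> (+) c ` A'))"
  \<comment> \<open>When \<open>B\<close> is a single point there are no residues modulo
    \<open>n\<close> to work with, but \<open>b = c = 0\<close> already gives |A|.\<close>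
  proof (cases "n = 0")
    case True
    have "(\<lambda>x. x mod int p) ` A' = id ` A'" by (rule image_cong) (use A'(1) in auto)
    then show ?thesis using True by simp
  next
    case False
    then show ?thesis
      using three_translates_cyclic[OF A'(1), of n] window assms(6) cardB Ap A'(3) by simp
  qed
  then obtain b c where bc: "b \<in> {0..int n}" "c \<in> {0..int n}"
    and card_ge: "card A' + n \<le> card ((\<lambda>x. x mod int p) ` (A' \<union> (+) b ` A' \<union> (+) c ` A'))"
    by blast
  let ?f = "\<lambda>i. (x + i) mod int p"
  \<comment> \<open>Adding an element of \<open>B\<close> to \<open>A\<close> is an integer
    translate of \<open>A'\<close> followed by one rotation by \<open>s + x\<close>, common to all
    three elements, which preserves the size of the union.\<close>
  have "(\<lambda>a. (a + ?f i) mod int p) ` A = (\<lambda>z. (z + (s + x)) mod int p) ` (+) i ` A'" for i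
    unfolding A'(2) image_image by (rule image_cong) (simp_all only: mod_add_eq, simp_all add: ac_simps)
  from this[of 0] this[of b] this[of c] have "A <+>\<^bsub>residue_ring (int p)\<^esub> {?f 0, ?f b, ?f c}
      = (\<lambda>z. (z + (s + x)) mod int p) ` (A' \<union> (+) b ` A' \<union> (+) c ` A')"
    unfolding sumset image_Un by (simp add: Un_assoc)
  then have "card A + n \<le> card (A <+>\<^bsub>residue_ring (int p)\<^esub> {?f 0, ?f b, ?f c})"
    using card_ge A'(3) by (simp add: card_translate_mod)
  moreover have "?f 0 \<in> B" "?f b \<in> B" "?f c \<in> B" using bc unfolding B by (intro imageI; simp)+
  ultimately show ?thesis using cardB by (metis add_diff_cancel_right' add.assoc)
qed

end
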